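(* Let $n\ge1$, let $\mu$ be a partition with $\mu_1\le n$, and let $1\le k\le n$. Then $$e^*_k(\widetilde\mu)=\sum hstrip_\mu(k)!,$$ where the sum ranges over all horizontal strips of length $k$ in the Ferrers diagram of $\mu$.
   Context: $\widetilde\mu$ is the conjugate partition of $\mu$, with $\widetilde\mu_i=0$ for $i>\mu_1$. The number $e^*_k(\widetilde\mu)$ is $$e^*_k(\widetilde\mu)=\sum_{1\le i_1<i_2<\cdots<i_k\le n}(\widetilde\mu_{i_1}+k-1)(\widetilde\mu_{i_2}+k-2)\cdots(\widetilde\mu_{i_k}).$$ The Ferrers diagram of $\mu$ has rows of lengths $\mu_1\ge\mu_2\ge\cdots$. A horizontal strip of length $k$ (in the generalized sense used here) is a set of $k$ cells of the Ferrers diagram no two of which lie in the same column. A horizontal component of a horizontal strip is the set of all its cells lying in one given row (not required to be contiguous), and $hstrip_\mu(k)!$ is the product of the factorials of the cardinalities of the horizontal components of the strip. *)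

theory Defs
  imports Main "HOL-Library.FuncSet"
begin

text \<open>
  A partition is the sequence of its parts \<open>\<mu> 1 \<ge> \<mu> 2 \<ge> \<dots>\<close>, eventually zero.
  Indices start at 1; the value \<open>\<mu> 0\<close> is irrelevant and never used.
\<close>

definition is_partition :: "(nat \<Rightarrow> nat) \<Rightarrow> bool" where
  "is_partition \<mu> \<longleftrightarrow>
     (\<forall>i\<ge>1. \<mu> (Suc i) \<le> \<mu> i) \<and> finite {i. 1 \<le> i \<and> \<mu> i \<noteq> 0}"

text \<open>Cells are pairs (row, column).\<close>

definition ferrers :: "(nat \<Rightarrow> nat) \<Rightarrow> (nat \<times> nat) set" where
  "ferrers \<mu> = {(r, c). 1 \<le> r \<and> 1 \<le> c \<and> c \<le> \<mu> r}"

text \<open>The parts of the conjugate are the column lengths; in particular the part with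
  index \<open>c\<close> is 0 whenever \<open>c > \<mu> 1\<close>.\<close>

definition conjugate :: "(nat \<Rightarrow> nat) \<Rightarrow> nat \<Rightarrow> nat" where
  "conjugate \<mu> c = card {r. (r, c) \<in> ferrers \<mu>}"

lemma conjugate_eq_0:
  assumes "is_partition \<mu>" and "\<mu> 1 < c"
  shows "conjugate \<mu> c = 0"
proof -
  have "\<mu> r \<le> \<mu> 1" if "1 \<le> r" for r
    using that
  proof (induction r rule: dec_induct)
    case (step i)
    then show ?case
      using assms(1) unfolding is_partition_def by (meson le_trans)
  qed simp
  then have "{r. (r, c) \<in> ferrers \<mu>} = {}"
    using assms(2) unfolding ferrers_def by fastforce
  then show ?thesis
    unfolding conjugate_def by simp
qed

text \<open>
  The summation index \<open>i\<close> runs over the sequences \<open>1 \<le> i 1 < \<dots> < i k \<le> n\<close>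
  (extensional functions, so that each sequence is counted once).
\<close>

definition estar :: "nat \<Rightarrow> nat \<Rightarrow> (nat \<Rightarrow> nat) \<Rightarrow> nat" where
  "estar n k x =
     (\<Sum>i \<in> {i \<in> {1..k} \<rightarrow>\<^sub>E {1..n}. strict_mono_on {1..k} i}.
        \<Prod>j = 1..k. x (i j) + (k - j))"

definition horizontal_strips :: "(nat \<Rightarrow> nat) \<Rightarrow> nat \<Rightarrow> (nat \<times> nat) set set" where
  "horizontal_strips \<mu> k = {S. S \<subseteq> ferrers \<mu> \<and> card S = k \<and> inj_on snd S}"

definition horizontal_component :: "(nat \<times> nat) set \<Rightarrow> nat \<Rightarrow> (nat \<times> nat) set" where
  "horizontal_component S r = {p \<in> S. fst p = r}"

definition hstrip_fact :: "(nat \<times> nat) set \<Rightarrow> nat" where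
  "hstrip_fact S = (\<Prod>r \<in> fst ` S. fact (card (horizontal_component S r)))"

end

(* Both sides are sorted by the set C of columns met by the strip. For fixed C, choose the cells of
   the strip from the rightmost column of C to the leftmost one. Every row used so far meets the next
   column c, and putting a cell into row r multiplies the weight by one plus the number of cells
   already in r. Summing over the rows r of column c gives the factor: length of c plus number of
   columns of C to the right of c. *)
theory Submission
  imports Defs
begin

text \<open>The fibre of the strips over their set of columns. Injectivity of \<open>snd\<close>
  makes the number of cells equal to the size of \<open>C\<close>, so fixing \<open>C\<close> also
  fixes the length.\<close>

definition strips_on :: "(nat \<Rightarrow> nat) \<Rightarrow> nat set \<Rightarrow> (nat \<times> nat) set set" where
  "strips_on \<mu> C = {S. S \<subseteq> ferrers \<mu> \<and> inj_on snd S \<and> snd ` S = C}"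

lemma finite_strip:
  assumes "S \<in> strips_on \<mu> C" "finite C"
  shows "finite S" "card S = card C"
  using assms unfolding strips_on_def by (auto dest: finite_image_iff simp: card_image[symmetric])

lemma ferrers_moves_left: "(r, d) \<in> ferrers \<mu> \<Longrightarrow> 1 \<le> c \<Longrightarrow> c \<le> d \<Longrightarrow> (r, c) \<in> ferrers \<mu>"
  unfolding ferrers_def by auto

lemma finite_column:
  assumes "is_partition \<mu>"
  shows "finite {r. (r, c) \<in> ferrers \<mu>}"
proof (rule finite_subset)
  show "{r. (r, c) \<in> ferrers \<mu>} \<subseteq> {i. 1 \<le> i \<and> \<mu> i \<noteq> 0}"
    unfolding ferrers_def by auto
  show "finite {i. 1 \<le> i \<and> \<mu> i \<noteq> 0}"
    using assms unfolding is_partition_def by blast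
qed

lemma partition_le_first:
  assumes "is_partition \<mu>" "1 \<le> r"
  shows "\<mu> r \<le> \<mu> 1"
  using assms(2)
proof (induction r rule: dec_induct)
  case (step i)
  then show ?case using assms(1) unfolding is_partition_def by (meson le_trans)
qed simp

lemma finite_ferrers:
  assumes "is_partition \<mu>"
  shows "finite (ferrers \<mu>)"
proof (rule finite_subset)
  show "ferrers \<mu> \<subseteq> (\<lambda>(c, r). (r, c)) ` (SIGMA c:{1..\<mu> 1}. {r. (r, c) \<in> ferrers \<mu>})"
    using partition_le_first[OF assms] unfolding ferrers_def
    by (force intro: le_trans simp: image_iff)
  show "finite ((\<lambda>(c, r). (r, c)) ` (SIGMA c:{1..\<mu> 1}. {r. (r, c) \<in> ferrers \<mu>}))"
    using finite_column[OF assms] by auto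
qed

text \<open>A row missed by \<open>S\<close> contributes 0! = 1. The index set can therefore be
  enlarged, which lets the weights of two strips be compared over the same rows.\<close>

lemma hstrip_fact_superset:
  assumes "finite R" "fst ` S \<subseteq> R"
  shows "hstrip_fact S = (\<Prod>r\<in>R. fact (card (horizontal_component S r)))"
  unfolding hstrip_fact_def
proof (rule prod.mono_neutral_left[OF assms], intro ballI)
  fix r assume "r \<in> R - fst ` S"
  then have "horizontal_component S r = {}"
    unfolding horizontal_component_def by force
  then show "fact (card (horizontal_component S r)) = (1::nat)" by simp
qed

text \<open>Only the component of row \<open>r\<close> grows, say from m to m + 1 cells, and (m +
  1)! = (m + 1) * m!.\<close>

lemma hstrip_fact_insert:
  assumes "finite S" "(r, c) \<notin> S"
  shows "hstrip_fact (insert (r, c) S) = Suc (card (horizontal_component S r)) * hstrip_fact S"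
proof -
  \<comment> \<open>\<open>R\<close> contains \<open>r\<close> even when \<open>S\<close> has no
    cell in that row, so it serves for both strips.\<close>
  define R where "R = insert r (fst ` S)"
  have fin: "finite R" "r \<in> R" using assms(1) unfolding R_def by auto
  have same: "horizontal_component (insert (r, c) S) r = insert (r, c) (horizontal_component S r)"
    unfolding horizontal_component_def by auto
  have other: "horizontal_component (insert (r, c) S) q = horizontal_component S q" if "q \<noteq> r" for q
    using that unfolding horizontal_component_def by auto
  have card: "card (insert (r, c) (horizontal_component S r)) = Suc (card (horizontal_component S r))"
    using assms unfolding horizontal_component_def by simp
  have "hstrip_fact (insert (r, c) S) = (\<Prod>q\<in>R. fact (card (horizontal_component (insert (r, c) S) q)))"
    by (rule hstrip_fact_superset) (auto simp: R_def assms)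
  also have "\<dots> = fact (Suc (card (horizontal_component S r)))
      * (\<Prod>q\<in>R - {r}. fact (card (horizontal_component S q)))"
    using fin by (simp add: prod.remove[of R r] same card other)
  also have "\<dots> = Suc (card (horizontal_component S r))
      * (\<Prod>q\<in>R. fact (card (horizontal_component S q)))"
    using fin by (simp add: prod.remove[of R r] algebra_simps)
  also have "(\<Prod>q\<in>R. fact (card (horizontal_component S q))) = hstrip_fact S"
    by (rule hstrip_fact_superset[symmetric]) (auto simp: R_def assms)
  finally show ?thesis .
qed

lemma sum_card_horizontal_component:
  assumes "finite S" "finite R" "fst ` S \<subseteq> R"
  shows "(\<Sum>r\<in>R. card (horizontal_component S r)) = card S"
  using sum.group[OF assms, of "\<lambda>_. 1::nat"] unfolding horizontal_component_def by simp

text \<open>A strip over \<open>insert c C\<close> has exactly one cell in column \<open>c\<close>;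
  removing that cell inverts the map.\<close>

lemma strips_on_insert:
  assumes "c \<notin> C"
  shows "bij_betw (\<lambda>(S, r). insert (r, c) S)
           (strips_on \<mu> C \<times> {r. (r, c) \<in> ferrers \<mu>}) (strips_on \<mu> (insert c C))"
  unfolding bij_betw_def
proof
  show "inj_on (\<lambda>(S, r). insert (r, c) S) (strips_on \<mu> C \<times> {r. (r, c) \<in> ferrers \<mu>})"
  proof (rule inj_onI, clarify)
    fix S r S' r'
    assume S: "S \<in> strips_on \<mu> C" and S': "S' \<in> strips_on \<mu> C"
      and eq: "insert (r, c) S = insert (r', c) S'"
    have no: "(q, c) \<notin> S" "(q, c) \<notin> S'" for q
      using S S' assms unfolding strips_on_def by force+
    have "r = r'" using eq no by blast
    moreover have "S = S'" using eq no \<open>r = r'\<close> by (metis insert_ident)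
    ultimately show "S = S' \<and> r = r'" by blast
  qed
  show "(\<lambda>(S, r). insert (r, c) S) ` (strips_on \<mu> C \<times> {r. (r, c) \<in> ferrers \<mu>})
      = strips_on \<mu> (insert c C)"
  proof (intro equalityI subsetI)
    fix T assume "T \<in> (\<lambda>(S, r). insert (r, c) S) ` (strips_on \<mu> C \<times> {r. (r, c) \<in> ferrers \<mu>})"
    then obtain S r where T: "T = insert (r, c) S" "S \<in> strips_on \<mu> C" "(r, c) \<in> ferrers \<mu>"
      by auto
    then show "T \<in> strips_on \<mu> (insert c C)"
      using assms unfolding strips_on_def by auto
  next
    fix T assume T: "T \<in> strips_on \<mu> (insert c C)"
    then obtain r where r: "(r, c) \<in> T" unfolding strips_on_def by force
    have inj: "inj_on snd T" "snd ` T = insert c C" "T \<subseteq> ferrers \<mu>"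
      using T unfolding strips_on_def by auto
    have "snd ` (T - {(r, c)}) = C"
      using inj_on_image_set_diff[OF inj(1), of T "{(r, c)}"] r inj(2) assms by auto
    then have "T - {(r, c)} \<in> strips_on \<mu> C"
      using inj unfolding strips_on_def by (auto intro: inj_on_subset)
    moreover have "T = insert (r, c) (T - {(r, c)})" "(r, c) \<in> ferrers \<mu>" using r inj by auto
    ultimately show "T \<in> (\<lambda>(S, r). insert (r, c) S) ` (strips_on \<mu> C \<times> {r. (r, c) \<in> ferrers \<mu>})"
      by (intro image_eqI[of _ _ "(T - {(r, c)}, r)"]) auto
  qed
qed

lemma sum_strips_on:
  assumes "is_partition \<mu>" "finite C" "\<forall>c\<in>C. 1 \<le> c"
  shows "(\<Sum>S\<in>strips_on \<mu> C. hstrip_fact S) = (\<Prod>c\<in>C. conjugate \<mu> c + card {d\<in>C. c < d})"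
  using assms(2,3)
\<comment> \<open>Each step inserts a new least column \<open>c\<close>, so all cells placed before
  lie to the right of \<open>c\<close>.\<close>
proof (induction C rule: finite_linorder_min_induct)
  case empty
  have "strips_on \<mu> {} = {{}}" unfolding strips_on_def by auto
  then show ?case by (simp add: hstrip_fact_def)
next
  case (insert c C)
  let ?R = "{r. (r, c) \<in> ferrers \<mu>}"
  have c: "c \<notin> C" using insert.hyps(2) by blast
  have step: "(\<Sum>r\<in>?R. hstrip_fact (insert (r, c) S)) = (conjugate \<mu> c + card C) * hstrip_fact S"
    if S: "S \<in> strips_on \<mu> C" for S
  proof -
    have no: "(r, c) \<notin> S" for r using S c unfolding strips_on_def by force
    \<comment> \<open>A row with a cell to the right of column \<open>c\<close> also meets column
      \<open>c\<close>. Summing component sizes over \<open>?R\<close> thus counts every cell of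
      \<open>S\<close>.\<close>
    have "fst ` S \<subseteq> ?R"
    proof clarify
      fix r d assume rd: "(r, d) \<in> S"
      then have "d \<in> C" "(r, d) \<in> ferrers \<mu>" using S unfolding strips_on_def by force+
      then show "(fst (r, d), c) \<in> ferrers \<mu>"
        using ferrers_moves_left[of r d \<mu> c] insert.hyps(2) insert.prems by fastforce
    qed
    then have "(\<Sum>r\<in>?R. card (horizontal_component S r)) = card C"
      using sum_card_horizontal_component finite_column[OF assms(1)] finite_strip[OF S insert.hyps(1)]
      by metis
    \<comment> \<open>The ones add up to the length of column \<open>c\<close>, the component sizes
      to \<open>card C\<close>.\<close>
    then have "(\<Sum>r\<in>?R. Suc (card (horizontal_component S r))) = conjugate \<mu> c + card C"
      unfolding conjugate_def by (simp add: sum_Suc)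
    then show ?thesis
      using finite_strip(1)[OF S insert.hyps(1)] no
      by (simp only: hstrip_fact_insert not_False_eq_True sum_distrib_right[symmetric])
  qed
  have "(\<Sum>S\<in>strips_on \<mu> (insert c C). hstrip_fact S)
      = (\<Sum>(S, r)\<in>strips_on \<mu> C \<times> ?R. hstrip_fact (insert (r, c) S))"
    by (subst sum.reindex_bij_betw[OF strips_on_insert[OF c], symmetric]) (simp add: case_prod_unfold)
  also have "\<dots> = (\<Sum>S\<in>strips_on \<mu> C. (conjugate \<mu> c + card C) * hstrip_fact S)"
    by (simp add: sum.cartesian_product[symmetric] step)
  also have "\<dots> = (conjugate \<mu> c + card C) * (\<Prod>b\<in>C. conjugate \<mu> b + card {d\<in>C. b < d})"
    using insert.IH insert.prems by (simp add: sum_distrib_left[symmetric])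
  also have "\<dots> = (\<Prod>b\<in>insert c C. conjugate \<mu> b + card {d\<in>insert c C. b < d})"
  proof -
    \<comment> \<open>The new minimum sees all of \<open>C\<close> to its right and is itself to the
      right of no column in \<open>C\<close>, so the earlier factors keep their value.\<close>
    have "{d\<in>insert c C. c < d} = C" using insert.hyps(2) by auto
    moreover have "{d\<in>insert c C. b < d} = {d\<in>C. b < d}" if "b \<in> C" for b
      using insert.hyps(2) that by auto
    ultimately show ?thesis using c insert.hyps(1) by simp
  qed
  finally show ?case .
qed

text \<open>The values above \<open>i j\<close> are those at the positions \<open>j + 1\<close> to
  \<open>k\<close>. This expresses the shift \<open>k - j\<close> in \<open>estar\<close> through
  the set of values alone.\<close>

lemma card_above_strict_mono:
  fixes i :: "nat \<Rightarrow> nat"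
  assumes "strict_mono_on {1..k} i" "j \<in> {1..k}"
  shows "card {d \<in> i ` {1..k}. i j < d} = k - j"
proof -
  have "{d \<in> i ` {1..k}. i j < d} = i ` {Suc j..k}"
    using assms strict_mono_on_less[OF assms(1)] by auto
  moreover have "inj_on i {Suc j..k}"
    by (rule inj_on_subset[OF strict_mono_on_imp_inj_on[OF assms(1)]]) auto
  ultimately show ?thesis by (simp add: card_image)
qed

lemma strict_mono_sequences_bij_subsets:
  "bij_betw (\<lambda>i. i ` {1..k}) {i \<in> {1..k} \<rightarrow>\<^sub>E {1..n}. strict_mono_on {1..k} i}
     {C. C \<subseteq> {1..n::nat} \<and> card C = k}"
  unfolding bij_betw_def
proof
  let ?I = "{i \<in> {1..k} \<rightarrow>\<^sub>E {1..n}. strict_mono_on {1..k} i}"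
  show "inj_on (\<lambda>i. i ` {1..k}) ?I"
  proof (rule inj_onI, clarify)
    fix f g
    assume f: "f \<in> {1..k} \<rightarrow>\<^sub>E {1..n}" "strict_mono_on {1..k} f"
      and g: "g \<in> {1..k} \<rightarrow>\<^sub>E {1..n}" "strict_mono_on {1..k} g"
      and eq: "f ` {1..k} = g ` {1..k}"
    show "f = g"
    proof (rule PiE_ext[OF f(1) g(1)])
      fix j assume j: "j \<in> {1..k}"
      then obtain l where l: "l \<in> {1..k}" "f j = g l" using eq by (metis image_iff)
      \<comment> \<open>The common value has equally many larger elements in the common image, and
        this number determines its position.\<close>
      then have "k - j = k - l"
        using card_above_strict_mono[OF f(2) j] card_above_strict_mono[OF g(2) l(1)] eq by simp
      then have "j = l" using j l(1) by auto
      then show "f j = g j" using l(2) by simp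
    qed
  qed
  show "(\<lambda>i. i ` {1..k}) ` ?I = {C. C \<subseteq> {1..n} \<and> card C = k}"
  proof (intro equalityI subsetI)
    fix C assume "C \<in> (\<lambda>i. i ` {1..k}) ` ?I"
    then obtain i where i: "i \<in> {1..k} \<rightarrow>\<^sub>E {1..n}" "strict_mono_on {1..k} i" "C = i ` {1..k}" by blast
    then show "C \<in> {C. C \<subseteq> {1..n} \<and> card C = k}"
      using strict_mono_on_imp_inj_on[OF i(2)] by (auto simp: card_image PiE_iff)
  next
    fix C assume C: "C \<in> {C. C \<subseteq> {1..n} \<and> card C = k}"
    then have fin: "finite C" by (auto intro: finite_subset)
    define xs where "xs = sorted_list_of_set C"
    have xs: "set xs = C" "length xs = k" "sorted_wrt (<) xs"
      using C fin unfolding xs_def by auto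
    \<comment> \<open>The increasing enumeration of \<open>C\<close>: list positions start at 0 and
      sequence indices at 1, and \<open>restrict\<close> makes the function extensional.\<close>
    define i where "i = restrict (\<lambda>j. xs ! (j - 1)) {1..k}"
    have "i ` {1..k} = (\<lambda>j. xs ! (j - 1)) ` Suc ` {..<k}"
      unfolding i_def by (simp add: image_Suc_lessThan)
    also have "\<dots> = C" using xs by (auto simp: set_conv_nth image_image)
    finally have im: "i ` {1..k} = C" .
    have "strict_mono_on {1..k} i"
      using xs(2) sorted_wrt_nth_less[OF xs(3)]
      unfolding i_def strict_mono_on_def by auto
    moreover have "i \<in> {1..k} \<rightarrow>\<^sub>E {1..n}"
      using im C unfolding i_def by auto
    ultimately show "C \<in> (\<lambda>i. i ` {1..k}) ` ?I" using im by blast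
  qed
qed

text \<open>Replacing a sequence by its set of values brings \<open>estar\<close> into the form that
  \<open>sum_strips_on\<close> produces for each set of columns.\<close>

lemma estar_sum_subsets:
  "estar n k x = (\<Sum>C | C \<subseteq> {1..n} \<and> card C = k. \<Prod>c\<in>C. x c + card {d\<in>C. c < d})"
proof -
  have "(\<Prod>c\<in>i ` {1..k}. x c + card {d\<in>i ` {1..k}. c < d}) = (\<Prod>j = 1..k. x (i j) + (k - j))"
    if "strict_mono_on {1..k} i" for i
    using strict_mono_on_imp_inj_on[OF that] card_above_strict_mono[OF that]
    by (simp add: prod.reindex)
  then show ?thesis
    unfolding estar_def
    by (subst sum.reindex_bij_betw[OF strict_mono_sequences_bij_subsets, symmetric]) simp
qed

theorem proposition4p7:
  fixes n k :: nat and \<mu> :: "nat \<Rightarrow> nat"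
  assumes "n \<ge> 1"
    and "is_partition \<mu>"
    and "\<mu> 1 \<le> n"
    and "1 \<le> k" and "k \<le> n"
  shows "estar n k (conjugate \<mu>) = (\<Sum>S \<in> horizontal_strips \<mu> k. hstrip_fact S)"
proof -
  let ?T = "{C. C \<subseteq> {1..n} \<and> card C = k}"
  have fin: "finite (horizontal_strips \<mu> k)"
    by (rule finite_subset[OF _ finite_Pow_iff[THEN iffD2, OF finite_ferrers[OF assms(2)]]])
      (auto simp: horizontal_strips_def)
  have "snd ` ferrers \<mu> \<subseteq> {1..n}"
    using partition_le_first[OF assms(2)] assms(3) unfolding ferrers_def by fastforce
  \<comment> \<open>A strip of length \<open>k\<close> meets exactly \<open>k\<close> columns, all
    within the first \<open>n\<close> since no row is longer than \<open>\<mu> 1\<close>.\<close>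
  then have cols: "(`) snd ` horizontal_strips \<mu> k \<subseteq> ?T"
    unfolding horizontal_strips_def by (auto simp: card_image)
  have fib: "{S \<in> horizontal_strips \<mu> k. snd ` S = C} = strips_on \<mu> C" if "C \<in> ?T" for C
    using that unfolding horizontal_strips_def strips_on_def by (auto simp: card_image)
  have "(\<Sum>S\<in>horizontal_strips \<mu> k. hstrip_fact S)
      = (\<Sum>C\<in>?T. \<Sum>S\<in>strips_on \<mu> C. hstrip_fact S)"
    using sum.group[OF fin _ cols, of hstrip_fact] fib by simp
  also have "\<dots> = (\<Sum>C\<in>?T. \<Prod>c\<in>C. conjugate \<mu> c + card {d\<in>C. c < d})"
    by (rule sum.cong[OF refl], rule sum_strips_on[OF assms(2)]) (auto intro: finite_subset)
  finally show ?thesis by (simp add: estar_sum_subsets)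
qed

end
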